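(* Consider an uncertain optimization problem with uncertainty set $\mathcal{U}=\mathrm{conv}(\mathcal{U}')$, where $\mathcal{U}':=\{\xi^1,\ldots,\xi^N\}$. Let $F$ consist of $m$ constraints $F_i:\mathbb{R}^n\times\mathcal{U}\to\mathbb{R}$, $i=1,\ldots,m$, and let each $F_i$ and $f:\mathbb{R}^n\times\mathcal{U}\to\mathbb{R}$ be jointly quasiconvex in the arguments $(y,\xi)$. Let $d(x,\cdot)$ be quasiconvex (for every $x$). Let $\mathcal{X}$ be convex. Then $\mathrm{Rec}(\mathcal{U})$ and $\mathrm{Rec}(\mathcal{U}')$ have the same set of recoverable-robust solutions.
   Context: $\mathcal{X}\subseteq\mathbb{R}^n$ is closed, $\mathcal{U}\subseteq\mathbb{R}^M$ has at least two elements, for each $\xi\in\mathcal{U}$ the functions $F(\cdot,\xi):\mathbb{R}^n\to\mathbb{R}^m$ and $f(\cdot,\xi):\mathbb{R}^n\to\mathbb{R}$ are continuous, and $d:\mathbb{R}^n\times\mathbb{R}^n\to\mathbb{R}$ is a metric. The uncertain problem is the family $\mathrm{P}(\xi)$, $\xi\in\mathcal{U}$: minimize $f(x,\xi)$ subject to $F(x,\xi)\le 0$ (componentwise), $x\in\mathcal{X}$. For a set of scenarios $\mathcal{V}\subseteq\mathcal{U}$, $\mathrm{Rec}(\mathcal{V})$ is the biobjective problem: minimize $(\mathbf{f}_{\mathcal{V}}(y),\mathbf{r}_{\mathcal{V}}(x,y))=\left(\sup_{\xi\in\mathcal{V}}f(y(\xi),\xi),\ \sup_{\xi\in\mathcal{V}}d(x,y(\xi))\right)$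 subject to $F(y(\xi),\xi)\le 0$ for all $\xi\in\mathcal{V}$, $x\in\mathcal{X}$, $y:\mathcal{V}\to\mathcal{X}$. A feasible $(x,y)$ is Pareto efficient for $\mathrm{Rec}(\mathcal{V})$ if there is no feasible $(x',y')$ with $\mathbf{f}_{\mathcal{V}}(y')\le\mathbf{f}_{\mathcal{V}}(y)$ and $\mathbf{r}_{\mathcal{V}}(x',y')\le\mathbf{r}_{\mathcal{V}}(x,y)$ where at least one of the inequalities is strict. A point $x\in\mathcal{X}$ is a recoverable-robust solution of $\mathrm{Rec}(\mathcal{V})$ if there exists $y:\mathcal{V}\to\mathcal{X}$ such that $(x,y)$ is Pareto efficient for $\mathrm{Rec}(\mathcal{V})$. *)

theory Defs
  imports "HOL-Analysis.Analysis"
begin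

definition quasiconvex_on :: "'a::real_vector set \<Rightarrow> ('a \<Rightarrow> real) \<Rightarrow> bool"
  where "quasiconvex_on S g \<longleftrightarrow> convex S \<and>
    (\<forall>x\<in>S. \<forall>y\<in>S. \<forall>u\<ge>0. \<forall>v\<ge>0. u + v = 1 \<longrightarrow> g (u *\<^sub>R x + v *\<^sub>R y) \<le> max (g x) (g y))"

(* In the problem Rec(V), a second-stage policy y : V -> X is represented by a total function
   of which only the values on V matter. *)

definition rec_feasible ::
    "(real^'n) set \<Rightarrow> (real^'n \<Rightarrow> real^'k \<Rightarrow> real^'m) \<Rightarrow> (real^'k) set
      \<Rightarrow> real^'n \<Rightarrow> (real^'k \<Rightarrow> real^'n) \<Rightarrow> bool"
  where "rec_feasible X F V x y \<longleftrightarrow>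
    x \<in> X \<and> y \<in> V \<rightarrow> X \<and> (\<forall>\<xi>\<in>V. \<forall>i. F (y \<xi>) \<xi> $ i \<le> 0)"

(* The suprema over an infinite V may be infinite, so both objectives are extended-real valued. *)

definition rec_obj ::
    "(real^'n \<Rightarrow> real^'k \<Rightarrow> real) \<Rightarrow> (real^'k) set \<Rightarrow> (real^'k \<Rightarrow> real^'n) \<Rightarrow> ereal"
  where "rec_obj f V y = (SUP \<xi>\<in>V. ereal (f (y \<xi>) \<xi>))"

definition rec_dist ::
    "(real^'n \<Rightarrow> real^'n \<Rightarrow> real) \<Rightarrow> (real^'k) set
      \<Rightarrow> real^'n \<Rightarrow> (real^'k \<Rightarrow> real^'n) \<Rightarrow> ereal"
  where "rec_dist d V x y = (SUP \<xi>\<in>V. ereal (d x (y \<xi>)))"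

definition pareto_efficient ::
    "(real^'n) set \<Rightarrow> (real^'n \<Rightarrow> real^'k \<Rightarrow> real^'m) \<Rightarrow> (real^'n \<Rightarrow> real^'k \<Rightarrow> real)
      \<Rightarrow> (real^'n \<Rightarrow> real^'n \<Rightarrow> real) \<Rightarrow> (real^'k) set
      \<Rightarrow> real^'n \<Rightarrow> (real^'k \<Rightarrow> real^'n) \<Rightarrow> bool"
  where "pareto_efficient X F f d V x y \<longleftrightarrow>
    rec_feasible X F V x y \<and>
    \<not> (\<exists>x' y'. rec_feasible X F V x' y' \<and>
          rec_obj f V y' \<le> rec_obj f V y \<and> rec_dist d V x' y' \<le> rec_dist d V x y \<and>
          (rec_obj f V y' < rec_obj f V y \<or> rec_dist d V x' y' < rec_dist d V x y))"

definition recoverable_robust_solutions ::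
    "(real^'n) set \<Rightarrow> (real^'n \<Rightarrow> real^'k \<Rightarrow> real^'m) \<Rightarrow> (real^'n \<Rightarrow> real^'k \<Rightarrow> real)
      \<Rightarrow> (real^'n \<Rightarrow> real^'n \<Rightarrow> real) \<Rightarrow> (real^'k) set \<Rightarrow> (real^'n) set"
  where "recoverable_robust_solutions X F f d V =
    {x \<in> X. \<exists>y \<in> V \<rightarrow> X. pareto_efficient X F f d V x y}"

end

(* A policy y on U' extends to conv U': the projection of the convex hull of the graph
   {(y \<xi>, \<xi>) | \<xi> \<in> U'} to the scenario space is conv U', so over each scenario \<xi> one can pick a
   point (z \<xi>, \<xi>) of that hull. All constraints and objective bounds that hold on the graph cut out
   convex sets by quasiconvexity, hence persist at (z \<xi>, \<xi>). Thus passing from U' to conv U' costs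
   nothing in either objective, while restriction from conv U' to U' cannot increase them, and
   dominating pairs can be transported in both directions. *)
theory Submission
  imports Defs
begin

text \<open>The level \<open>M\<close> is extended real so that a supremum such as
  \<open>rec_obj f V y\<close>, possibly infinite, can itself serve as the level.\<close>

lemma convex_quasiconvex_sublevel:
  assumes "quasiconvex_on S g"
  shows "convex {p \<in> S. ereal (g p) \<le> M}"
proof (rule convexI)
  fix p q and u v :: real
  assume p: "p \<in> {p \<in> S. ereal (g p) \<le> M}" and q: "q \<in> {p \<in> S. ereal (g p) \<le> M}"
    and uv: "0 \<le> u" "0 \<le> v" "u + v = 1"
  have "g (u *\<^sub>R p + v *\<^sub>R q) \<le> max (g p) (g q)"
    using assms p q uv by (simp add: quasiconvex_on_def)
  moreover have "ereal (max (g p) (g q)) \<le> M"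
    using p q by (simp add: max_def)
  ultimately have "ereal (g (u *\<^sub>R p + v *\<^sub>R q)) \<le> M"
    by (meson ereal_less_eq(3) order_trans)
  moreover have "u *\<^sub>R p + v *\<^sub>R q \<in> S"
    using assms p q uv by (simp add: quasiconvex_on_def convexD)
  ultimately show "u *\<^sub>R p + v *\<^sub>R q \<in> {p \<in> S. ereal (g p) \<le> M}"
    by simp
qed

text \<open>Projections are linear, so they commute with convex hulls; \<open>z\<close> is then a
  choice function. It need not agree with \<open>y\<close> on \<open>V\<close>.\<close>

lemma policy_extension:
  fixes y :: "'b::real_vector \<Rightarrow> 'a::real_vector"
  obtains z where "\<And>\<xi>. \<xi> \<in> convex hull V \<Longrightarrow> (z \<xi>, \<xi>) \<in> convex hull ((\<lambda>\<xi>. (y \<xi>, \<xi>)) ` V)"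
proof -
  let ?G = "(\<lambda>\<xi>. (y \<xi>, \<xi>)) ` V"
  have "snd ` (convex hull ?G) = convex hull (snd ` ?G)"
    by (rule convex_hull_linear_image [OF linear_snd])
  then have "snd ` (convex hull ?G) = convex hull V"
    by (simp add: image_image)
  then have "\<forall>\<xi>\<in>convex hull V. \<exists>w. (w, \<xi>) \<in> convex hull ?G"
    by force
  then show thesis
    using that by metis
qed

text \<open>The point \<open>x\<close> is kept and only the policy changes. A single
  \<open>z\<close> meets all requirements at once, since each is membership in a convex set
  containing the graph of \<open>y\<close>.\<close>

lemma rec_convex_hull_extension:
  fixes X :: "(real^'n) set" and V :: "(real^'k) set"
    and F :: "real^'n \<Rightarrow> real^'k \<Rightarrow> real^'m"
  assumes "convex X"
    and F: "\<And>i. quasiconvex_on (UNIV \<times> (convex hull V)) (\<lambda>(y, \<xi>). F y \<xi> $ i)"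
    and f: "quasiconvex_on (UNIV \<times> (convex hull V)) (\<lambda>(y, \<xi>). f y \<xi>)"
    and d: "quasiconvex_on UNIV (d x)"
    and feas: "rec_feasible X F V x y"
  obtains z where "rec_feasible X F (convex hull V) x z"
    and "rec_obj f (convex hull V) z \<le> rec_obj f V y"
    and "rec_dist d (convex hull V) x z \<le> rec_dist d V x y"
proof -
  let ?U = "convex hull V"
  let ?G = "(\<lambda>\<xi>. (y \<xi>, \<xi>)) ` V"
  obtain z where z: "\<And>\<xi>. \<xi> \<in> ?U \<Longrightarrow> (z \<xi>, \<xi>) \<in> convex hull ?G"
    using policy_extension by blast
  have hull: "(z \<xi>, \<xi>) \<in> C" if "\<xi> \<in> ?U" "convex C" "?G \<subseteq> C" for \<xi> C
    using z[OF that(1)] hull_minimal[of ?G C convex] that by blast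
  have VU: "\<xi> \<in> ?U" if "\<xi> \<in> V" for \<xi>
    using that by (rule hull_inc)
  have zX: "z \<xi> \<in> X" if "\<xi> \<in> ?U" for \<xi>
    using hull[OF that, of "X \<times> UNIV"] assms(1) feas
    by (auto simp: convex_Times rec_feasible_def)
  have zF: "F (z \<xi>) \<xi> $ i \<le> 0" if "\<xi> \<in> ?U" for \<xi> i
    using hull[OF that convex_quasiconvex_sublevel[OF F[of i], of 0]] feas VU
    by (auto simp: rec_feasible_def image_subset_iff)
  have yf: "ereal (f (y \<xi>) \<xi>) \<le> rec_obj f V y" if "\<xi> \<in> V" for \<xi>
    unfolding rec_obj_def using that by (rule SUP_upper)
  have yd: "ereal (d x (y \<xi>)) \<le> rec_dist d V x y" if "\<xi> \<in> V" for \<xi>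
    unfolding rec_dist_def using that by (rule SUP_upper)
  \<comment> \<open>The level is the worst case of \<open>y\<close> itself, so every point of the
    graph lies in the sublevel set.\<close>
  have zf: "ereal (f (z \<xi>) \<xi>) \<le> rec_obj f V y" if "\<xi> \<in> ?U" for \<xi>
    using hull[OF that convex_quasiconvex_sublevel[OF f, of "rec_obj f V y"]] VU yf
    by (auto simp: image_subset_iff)
  \<comment> \<open>\<open>d x\<close> does not involve the scenario, so the convex set is the
    cylinder over a sublevel set of \<open>d x\<close>.\<close>
  have zd: "ereal (d x (z \<xi>)) \<le> rec_dist d V x y" if "\<xi> \<in> ?U" for \<xi>
    using hull[OF that convex_Times
        [OF convex_quasiconvex_sublevel[OF d, of "rec_dist d V x y"] convex_UNIV]] yd
    by (auto simp: image_subset_iff)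
  show thesis
  proof (rule that)
    show "rec_feasible X F ?U x z"
      using zX zF feas by (auto simp: rec_feasible_def)
    show "rec_obj f ?U z \<le> rec_obj f V y"
      unfolding rec_obj_def[of f ?U] by (rule SUP_least) (rule zf)
    show "rec_dist d ?U x z \<le> rec_dist d V x y"
      unfolding rec_dist_def[of d ?U] by (rule SUP_least) (rule zd)
  qed
qed

lemma rec_feasible_subset:
  "rec_feasible X F U x y \<Longrightarrow> V \<subseteq> U \<Longrightarrow> rec_feasible X F V x y"
  by (auto simp: rec_feasible_def)

lemma rec_obj_mono: "V \<subseteq> U \<Longrightarrow> rec_obj f V y \<le> rec_obj f U y"
  by (simp add: rec_obj_def SUP_subset_mono)

lemma rec_dist_mono: "V \<subseteq> U \<Longrightarrow> rec_dist d V x y \<le> rec_dist d U x y"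
  by (simp add: rec_dist_def SUP_subset_mono)

text \<open>A pair dominating \<open>(x, z)\<close> for \<open>W\<close> is carried by
  \<open>sim\<close> to a pair for \<open>V\<close> that is at least as good, and hence dominates
  \<open>(x, y)\<close>. Keeping \<open>V\<close> and \<open>W\<close> arbitrary lets the lemma
  serve both inclusions.\<close>

lemma pareto_efficient_transfer:
  assumes "pareto_efficient X F f d V x y"
    and "rec_feasible X F W x z"
    and "rec_obj f W z \<le> rec_obj f V y" "rec_dist d W x z \<le> rec_dist d V x y"
    and sim: "\<And>x' y'. rec_feasible X F W x' y' \<Longrightarrow>
      \<exists>z'. rec_feasible X F V x' z' \<and> rec_obj f V z' \<le> rec_obj f W y'
        \<and> rec_dist d V x' z' \<le> rec_dist d W x' y'"
  shows "pareto_efficient X F f d W x z"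
  unfolding pareto_efficient_def
proof (intro conjI notI)
  show "rec_feasible X F W x z" by fact
  assume "\<exists>x' y'. rec_feasible X F W x' y' \<and>
      rec_obj f W y' \<le> rec_obj f W z \<and> rec_dist d W x' y' \<le> rec_dist d W x z \<and>
      (rec_obj f W y' < rec_obj f W z \<or> rec_dist d W x' y' < rec_dist d W x z)"
  then obtain x' y' where "rec_feasible X F W x' y'"
    and dom: "rec_obj f W y' \<le> rec_obj f W z" "rec_dist d W x' y' \<le> rec_dist d W x z"
      "rec_obj f W y' < rec_obj f W z \<or> rec_dist d W x' y' < rec_dist d W x z"
    by blast
  then obtain z' where z': "rec_feasible X F V x' z'" "rec_obj f V z' \<le> rec_obj f W y'"
      "rec_dist d V x' z' \<le> rec_dist d W x' y'"
    using sim by blast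
  have "rec_obj f V z' \<le> rec_obj f V y" "rec_dist d V x' z' \<le> rec_dist d V x y"
    using z'(2,3) dom(1,2) assms(3,4) by order+
  \<comment> \<open>Strictness survives because it sits in the middle of the chain from
    \<open>z'\<close> via \<open>y'\<close> and \<open>z\<close> to \<open>y\<close>, whose outer
    links are weak.\<close>
  moreover have "rec_obj f V z' < rec_obj f V y \<or> rec_dist d V x' z' < rec_dist d V x y"
    using dom(3) z'(2,3) assms(3,4) by (elim disjE) (blast intro: le_less_trans less_le_trans)+
  ultimately show False
    using assms(1) z'(1) unfolding pareto_efficient_def by blast
qed

theorem theorem5:
  fixes X :: "(real^'n) set"
    and U U' :: "(real^'k) set"
    and \<xi>s :: "nat \<Rightarrow> real^'k"
    and N :: nat
    and F :: "real^'n \<Rightarrow> real^'k \<Rightarrow> real^'m"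
    and f :: "real^'n \<Rightarrow> real^'k \<Rightarrow> real"
    and d :: "real^'n \<Rightarrow> real^'n \<Rightarrow> real"
  assumes "closed X"
    and "\<exists>\<xi>\<in>U. \<exists>\<xi>'\<in>U. \<xi> \<noteq> \<xi>'"
    and "\<And>\<xi>. \<xi> \<in> U \<Longrightarrow> continuous_on UNIV (\<lambda>x. F x \<xi>)"
    and "\<And>\<xi>. \<xi> \<in> U \<Longrightarrow> continuous_on UNIV (\<lambda>x. f x \<xi>)"
    and "Metric_space UNIV d"
    and "U' = \<xi>s ` {1..N}"
    and "U = convex hull U'"
    and "\<And>i. quasiconvex_on (UNIV \<times> U) (\<lambda>(y, \<xi>). F y \<xi> $ i)"
    and "quasiconvex_on (UNIV \<times> U) (\<lambda>(y, \<xi>). f y \<xi>)"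
    and "\<And>x. quasiconvex_on UNIV (d x)"
    and "convex X"
  shows "recoverable_robust_solutions X F f d U = recoverable_robust_solutions X F f d U'"
proof -
  have sub: "U' \<subseteq> U"
    using assms(7) hull_subset by simp
  have restrict: "rec_feasible X F U' x y \<and> rec_obj f U' y \<le> rec_obj f U y
      \<and> rec_dist d U' x y \<le> rec_dist d U x y" if "rec_feasible X F U x y" for x y
    using rec_feasible_subset[OF that sub] rec_obj_mono[OF sub] rec_dist_mono[OF sub] by blast
  have extend: "\<exists>z. rec_feasible X F U x z \<and> rec_obj f U z \<le> rec_obj f U' y
      \<and> rec_dist d U x z \<le> rec_dist d U' x y" if "rec_feasible X F U' x y" for x y
    unfolding assms(7)
    by (rule rec_convex_hull_extension[where d = d, OF assms(11) assms(8)[unfolded assms(7)]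
          assms(9)[unfolded assms(7)] assms(10) that]) blast
  \<comment> \<open>Here \<open>y\<close> itself, read on \<open>U'\<close> only, is the new policy;
    competitors for \<open>U'\<close> are lifted by \<open>extend\<close>.\<close>
  have "pareto_efficient X F f d U' x y" if "pareto_efficient X F f d U x y" for x y
  proof -
    have "rec_feasible X F U x y"
      using that by (simp add: pareto_efficient_def)
    then show ?thesis
      using pareto_efficient_transfer[OF that, of U' y] restrict extend by blast
  qed
  \<comment> \<open>The roles swap: \<open>extend\<close> supplies the policy on \<open>U\<close>,
    and \<open>restrict\<close> brings competitors down to \<open>U'\<close>.\<close>
  moreover have "\<exists>z. pareto_efficient X F f d U x z" if "pareto_efficient X F f d U' x y" for x y
  proof -
    have "rec_feasible X F U' x y"
      using that by (simp add: pareto_efficient_def)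
    then show ?thesis
      using pareto_efficient_transfer[OF that, of U] restrict extend by blast
  qed
  moreover have "x \<in> X \<and> y \<in> V \<rightarrow> X" if "pareto_efficient X F f d V x y" for V x y
    using that by (simp add: pareto_efficient_def rec_feasible_def)
  ultimately show ?thesis
    unfolding recoverable_robust_solutions_def by blast
qed

end
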